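(* Let $q\ge 0$ and $p\ge 1$ be integers and let $\nu=\sum_{k=0}^{q} b_k\delta_{\lambda_k}$ be a finitely atomic charge, with $\lambda_0<\lambda_1<\dots<\lambda_q$ in $[1,+\infty)$ and nonzero real coefficients $b_0,\dots,b_q$, such that $\mu=\nu*\nu$ is a positive $p$-atomic measure with $p\le 6$. If $\nu*t\nu\ge 0$ (i.e. $\nu*t\nu$ is a positive measure), then the coefficients $b_k$ have constant sign (all $b_k>0$ or all $b_k<0$). In particular, $\mu$ admits a positive square root.
   Context: A charge is a (finite, real) signed Borel measure, not necessarily positive; $\delta_\lambda$ is the Dirac measure at $\lambda$. A measure is $p$-atomic if it is a linear combination with nonzero coefficients of Dirac measures at exactly $p$ distinct points. The multiplicative convolution of two finite (signed) measures is $[\nu*\mu](E)=\int\int \chi_E(xy)\,d\nu(x)\,d\mu(y)$, so that $\delta_a*\delta_b=\delta_{ab}$. For a (signed) measure $\nu$, $t\nu$ denotes the measure with $d(t\nu)(t)=t\,d\nu(t)$, so $t\delta_\lambda=\lambda\delta_\lambda$. A positive square root of a measure $\mu$ is a finite positive measure $\xi$ supported in $\mathbb{R}_+=[0,+\infty)$ with $\xi*\xi=\mu$. *)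

theory Defs
  imports "HOL-Probability.Probability"
begin

text \<open>
  A charge is a countably additive real-valued function on the Borel sets. As with the library's
  \<^const>\<open>measure\<close>, set functions take the value 0 outside the Borel sets, so that equality of charges
  is equality of functions.
\<close>

definition charge :: "(real set \<Rightarrow> real) \<Rightarrow> bool" where
  "charge \<nu> \<longleftrightarrow>
     (\<forall>E. E \<notin> sets borel \<longrightarrow> \<nu> E = 0) \<and> \<nu> {} = 0 \<and>
     (\<forall>A :: nat \<Rightarrow> real set. range A \<subseteq> sets borel \<longrightarrow> disjoint_family A \<longrightarrow>
        (\<lambda>i. \<nu> (A i)) sums \<nu> (\<Union>i. A i))"

definition positive_charge :: "(real set \<Rightarrow> real) \<Rightarrow> bool" where
  "positive_charge \<nu> \<longleftrightarrow> charge \<nu> \<and> (\<forall>E. 0 \<le> \<nu> E)"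

definition dirac :: "real \<Rightarrow> real set \<Rightarrow> real" where
  "dirac a = measure (return borel a)"

definition p_atomic :: "nat \<Rightarrow> (real set \<Rightarrow> real) \<Rightarrow> bool" where
  "p_atomic p \<mu> \<longleftrightarrow>
     (\<exists>S c. finite S \<and> card S = p \<and> (\<forall>s\<in>S. c s \<noteq> 0) \<and> \<mu> = (\<lambda>E. \<Sum>s\<in>S. c s * dirac s E))"

text \<open>
  The upper variation of a charge, i.e. the positive measure \<open>\<nu>\<^sup>+\<close> of the Jordan decomposition
  \<open>\<nu> = \<nu>\<^sup>+ - \<nu>\<^sup>-\<close>; the lower variation \<open>\<nu>\<^sup>-\<close> is the upper variation of \<open>-\<nu>\<close>. Negative values
  are cut off by \<^const>\<open>ennreal\<close>, harmlessly, since the empty set takes part in the supremum.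
\<close>

definition upper_variation :: "(real set \<Rightarrow> real) \<Rightarrow> real measure" where
  "upper_variation \<nu> =
     measure_of UNIV (sets borel) (\<lambda>E. SUP A\<in>{A \<in> sets borel. A \<subseteq> E}. ennreal (\<nu> A))"

definition charge_integral :: "(real set \<Rightarrow> real) \<Rightarrow> (real \<Rightarrow> real) \<Rightarrow> real" where
  "charge_integral \<nu> f =
     (\<integral>x. f x \<partial>upper_variation \<nu>) - (\<integral>x. f x \<partial>upper_variation (\<lambda>E. - \<nu> E))"

definition mult_convolution :: "(real set \<Rightarrow> real) \<Rightarrow> (real set \<Rightarrow> real) \<Rightarrow> real set \<Rightarrow> real" where
  "mult_convolution \<nu> \<mu> E =
     (if E \<in> sets borel
      then charge_integral \<mu> (\<lambda>y. charge_integral \<nu> (\<lambda>x. indicator E (x * y)))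
      else 0)"

text \<open>
  The charge \<open>t\<nu>\<close>, whose density with respect to \<open>\<nu>\<close> is the identity (meaningful when the identity is
  integrable with respect to \<open>\<nu>\<close>, in particular for finitely atomic \<open>\<nu>\<close>).
\<close>

definition times_t :: "(real set \<Rightarrow> real) \<Rightarrow> real set \<Rightarrow> real" where
  "times_t \<nu> E = (if E \<in> sets borel then charge_integral \<nu> (\<lambda>t. indicator E t * t) else 0)"

definition positive_square_root :: "(real set \<Rightarrow> real) \<Rightarrow> (real set \<Rightarrow> real) \<Rightarrow> bool" where
  "positive_square_root \<xi> \<mu> \<longleftrightarrow>
     positive_charge \<xi> \<and> \<xi> {..<0} = 0 \<and> mult_convolution \<xi> \<xi> = \<mu>"

end

theory Submission
  imports Defs
begin

text \<open>The mass of \<nu> * \<nu> at m is the sum of b_i b_j over the ordered pairs with l_i l_j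
  = m; the mass of \<nu> * t\<nu> there is half the sum of b_i b_j (l_i + l_j). For a fixed product,
  l_i + l_j is largest on the pair containing the smallest node. So if the other pairs contribute
  positively, that pair cannot cancel them without making \<nu> * t\<nu> negative
  (\<open>coeff_pos\<close>). Hence the three products of the two lowest nodes are atoms of \<mu>.
  Inversion t -> 1/t preserves both positivity hypotheses (\<open>positive_squares_rev\<close>), so
  the same holds for the two highest nodes.

  With five or more nodes these are six distinct atoms, and the next products force a seventh
  (\<open>more_than_six_atoms\<close>). Thus at most four nodes occur, few enough to read the signs
  off single masses (\<open>constant_sign\<close>). Given constant sign, the absolute value of \<nu>
  is a positive square root.\<close>

section \<open>Finitely atomic charges\<close>

lemma dirac_eq_indicator: "E \<in> sets borel \<Longrightarrow> dirac a E = indicator E a"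
  by (simp add: dirac_def measure_return)

lemma dirac_notin_borel: "E \<notin> sets borel \<Longrightarrow> dirac a E = 0"
  by (simp add: dirac_def measure_notin_sets)

lemma charge_dirac_sum:
  assumes "finite I"
  shows "charge (\<lambda>E. \<Sum>k\<in>I. c k * dirac (a k) E)"
  unfolding charge_def
proof (intro conjI allI impI)
  fix A :: "nat \<Rightarrow> real set"
  assume A: "range A \<subseteq> sets borel" "disjoint_family A"
  have "(\<lambda>i. dirac x (A i)) sums dirac x (\<Union>i. A i)" for x
  proof -
    interpret prob_space "return borel x"
      by (rule prob_space_return) simp
    show ?thesis
      unfolding dirac_def using A by (intro finite_measure_UNION) auto
  qed
  then show "(\<lambda>i. \<Sum>k\<in>I. c k * dirac (a k) (A i)) sums (\<Sum>k\<in>I. c k * dirac (a k) (\<Union>i. A i))"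
    by (intro sums_sum sums_mult)
qed (simp_all add: dirac_notin_borel dirac_eq_indicator)

text \<open>The supremum is attained by keeping exactly the atoms with positive coefficient.
  Injectivity of \<open>a\<close> prevents coefficients of opposite sign from sharing an
  atom.\<close>

lemma upper_variation_dirac_sum:
  fixes a :: "'i \<Rightarrow> real"
  assumes "finite I" and "inj_on a I"
  shows "upper_variation (\<lambda>E. \<Sum>k\<in>I. c k * dirac (a k) E) =
    distr (point_measure I (\<lambda>k. ennreal (max 0 (c k)))) borel a" (is "upper_variation ?\<nu> = ?N")
proof -
  have emeasure_N: "emeasure ?N E = ennreal (\<Sum>k\<in>I. max 0 (c k) * indicator E (a k))"
    if "E \<in> sets borel" for E
  proof -
    have "emeasure ?N E = emeasure (point_measure I (\<lambda>k. ennreal (max 0 (c k)))) (a -` E \<inter> I)"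
      using that by (subst emeasure_distr) (auto simp: space_point_measure measurable_def)
    also have "\<dots> = (\<Sum>k\<in>a -` E \<inter> I. ennreal (max 0 (c k)))"
      using assms by (intro emeasure_point_measure_finite) auto
    also have "\<dots> = ennreal (\<Sum>k\<in>a -` E \<inter> I. max 0 (c k))"
      by (subst sum_ennreal) auto
    also have "(\<Sum>k\<in>a -` E \<inter> I. max 0 (c k)) = (\<Sum>k\<in>I. max 0 (c k) * indicator E (a k))"
      using assms by (intro sum.mono_neutral_cong_left) (auto simp: indicator_def)
    finally show ?thesis .
  qed
  have sup: "(SUP A\<in>{A \<in> sets borel. A \<subseteq> E}. ennreal (?\<nu> A)) = emeasure ?N E"
    if E: "E \<in> sets borel" for E
  proof (rule antisym)
    show "(SUP A\<in>{A \<in> sets borel. A \<subseteq> E}. ennreal (?\<nu> A)) \<le> emeasure ?N E"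
    proof (rule SUP_least)
      fix A assume A: "A \<in> {A \<in> sets borel. A \<subseteq> E}"
      then have "c k * dirac (a k) A \<le> max 0 (c k) * indicator E (a k)" for k
        by (auto simp: dirac_eq_indicator indicator_def)
      then show "ennreal (?\<nu> A) \<le> emeasure ?N E"
        unfolding emeasure_N[OF E] by (intro ennreal_leI sum_mono)
    qed
    \<comment> \<open>The part of \<open>E\<close> in a Hahn positive set; it is Borel because there
      are finitely many atoms.\<close>
    let ?A = "E \<inter> a ` {k \<in> I. 0 < c k}"
    have A: "?A \<in> sets borel"
      using assms E by (intro sets.Int[OF E] borel_closed finite_imp_closed) auto
    have "c k * dirac (a k) ?A = max 0 (c k) * indicator E (a k)" if "k \<in> I" for k
    proof -
      have "a k \<in> ?A \<longleftrightarrow> a k \<in> E \<and> 0 < c k"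
        using that inj_onD[OF assms(2)] by auto
      then show ?thesis
        unfolding dirac_eq_indicator[OF A] by (simp add: indicator_def)
    qed
    then have "emeasure ?N E = ennreal (?\<nu> ?A)"
      unfolding emeasure_N[OF E] by simp
    also have "\<dots> \<le> (SUP A\<in>{A \<in> sets borel. A \<subseteq> E}. ennreal (?\<nu> A))"
      using A by (intro SUP_upper) auto
    finally show "emeasure ?N E \<le> (SUP A\<in>{A \<in> sets borel. A \<subseteq> E}. ennreal (?\<nu> A))" .
  qed
  \<comment> \<open>\<open>measure_of\<close> falls back to the zero measure unless its set function
    is a measure. Agreement with the measure \<open>?N\<close> on Borel sets settles this without a
    separate additivity proof.\<close>
  have "upper_variation ?\<nu> = measure_of (space ?N) (sets ?N) (emeasure ?N)"
    unfolding upper_variation_def using sup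
    by (simp, intro measure_of_eq) (auto simp: sets.sigma_sets_eq[of borel, simplified])
  then show ?thesis
    by (simp only: measure_of_of_measure)
qed

text \<open>The variations carry the weights max 0 c_k and max 0 (-c_k), whose difference is
  c_k.\<close>

lemma charge_integral_dirac_sum:
  fixes a :: "'i \<Rightarrow> real"
  assumes "finite I" and "inj_on a I" and "f \<in> borel_measurable borel"
  shows "charge_integral (\<lambda>E. \<Sum>k\<in>I. c k * dirac (a k) E) f = (\<Sum>k\<in>I. c k * f (a k))"
proof -
  have int: "(\<integral>x. f x \<partial>upper_variation (\<lambda>E. \<Sum>k\<in>I. d k * dirac (a k) E)) = (\<Sum>k\<in>I. max 0 (d k) * f (a k))"
    for d
  proof -
    have "(\<integral>x. f x \<partial>upper_variation (\<lambda>E. \<Sum>k\<in>I. d k * dirac (a k) E)) =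
        (\<integral>k. f (a k) \<partial>point_measure I (\<lambda>k. ennreal (max 0 (d k))))"
      unfolding upper_variation_dirac_sum[OF assms(1,2)]
      using assms(3) by (intro integral_distr) (auto simp: space_point_measure measurable_def)
    also have "\<dots> = (\<Sum>k\<in>I. max 0 (d k) * f (a k))"
      using assms(1) by (subst lebesgue_integral_point_measure_finite) auto
    finally show ?thesis .
  qed
  have neg: "(\<lambda>E. - (\<Sum>k\<in>I. c k * dirac (a k) E)) = (\<lambda>E. \<Sum>k\<in>I. (- c k) * dirac (a k) E)"
    by (simp add: sum_negf)
  show ?thesis
    unfolding charge_integral_def neg int
    by (simp add: sum_subtractf[symmetric] left_diff_distrib[symmetric]) (auto intro!: sum.cong)
qed

lemma times_t_dirac_sum:
  fixes a :: "'i \<Rightarrow> real"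
  assumes "finite I" and "inj_on a I"
  shows "times_t (\<lambda>E. \<Sum>k\<in>I. c k * dirac (a k) E) = (\<lambda>E. \<Sum>k\<in>I. (c k * a k) * dirac (a k) E)"
proof
  fix E
  show "times_t (\<lambda>E. \<Sum>k\<in>I. c k * dirac (a k) E) E = (\<Sum>k\<in>I. (c k * a k) * dirac (a k) E)"
  proof (cases "E \<in> sets borel")
    case True
    then have "(\<lambda>t. indicator E t * t :: real) \<in> borel_measurable borel"
      by measurable
    with assms True show ?thesis
      by (simp add: times_t_def charge_integral_dirac_sum dirac_eq_indicator mult_ac)
  qed (simp add: times_t_def dirac_notin_borel)
qed

text \<open>Each of the two integrals is a finite sum. The result stays a sum over index pairs,
  since distinct pairs may have the same product.\<close>

lemma mult_convolution_dirac_sum: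
  fixes a :: "'i \<Rightarrow> real" and a' :: "'j \<Rightarrow> real"
  assumes "finite I" and "inj_on a I" and "finite J" and "inj_on a' J" and E: "E \<in> sets borel"
  shows "mult_convolution (\<lambda>E. \<Sum>i\<in>I. c i * dirac (a i) E) (\<lambda>E. \<Sum>j\<in>J. d j * dirac (a' j) E) E =
    (\<Sum>(i, j)\<in>I \<times> J. c i * d j * indicator E (a i * a' j))"
proof -
  have meas: "(\<lambda>x. indicator E (x * y) :: real) \<in> borel_measurable borel"
    "(\<lambda>x. indicator E (y * x) :: real) \<in> borel_measurable borel" for y
    using borel_measurable_indicator[OF E]
    by (auto intro: measurable_compose[of "\<lambda>x. x * y" borel borel] measurable_compose[of "\<lambda>x. y * x" borel borel])
  have inner: "charge_integral (\<lambda>E. \<Sum>i\<in>I. c i * dirac (a i) E) (\<lambda>x. indicator E (x * y)) =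
      (\<Sum>i\<in>I. c i * indicator E (a i * y))" for y
    by (intro charge_integral_dirac_sum[OF assms(1,2)] meas)
  have "(\<lambda>y. \<Sum>i\<in>I. c i * indicator E (a i * y) :: real) \<in> borel_measurable borel"
    using meas(2) by (intro borel_measurable_sum borel_measurable_times) auto
  then show ?thesis
    unfolding mult_convolution_def inner sum.cartesian_product[symmetric]
    using E by (subst sum.swap) (simp add: charge_integral_dirac_sum[OF assms(3,4)] sum_distrib_left mult_ac)
qed

section \<open>Products of nodes\<close>

definition fibre :: "nat \<Rightarrow> (nat \<Rightarrow> real) \<Rightarrow> real \<Rightarrow> (nat \<times> nat) set" where
  "fibre q l m = {(i, j). i \<le> q \<and> j \<le> q \<and> l i * l j = m}"

text \<open>The mass of \<nu> * \<nu> at the point \<open>m\<close>, for \<nu> with nodes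
  \<open>l k\<close> and coefficients \<open>b k\<close>.\<close>

definition conv_coeff :: "nat \<Rightarrow> (nat \<Rightarrow> real) \<Rightarrow> (nat \<Rightarrow> real) \<Rightarrow> real \<Rightarrow> real" where
  "conv_coeff q l b m = (\<Sum>(i, j)\<in>fibre q l m. b i * b j)"

text \<open>The mass of \<nu> * t\<nu> at \<open>m\<close>; the factor \<open>l j\<close> comes from
  the second charge.\<close>

definition t_conv_coeff :: "nat \<Rightarrow> (nat \<Rightarrow> real) \<Rightarrow> (nat \<Rightarrow> real) \<Rightarrow> real \<Rightarrow> real" where
  "t_conv_coeff q l b m = (\<Sum>(i, j)\<in>fibre q l m. b i * b j * l j)"

lemma finite_fibre: "finite (fibre q l m)"
  by (rule finite_subset[of _ "{..q} \<times> {..q}"]) (auto simp: fibre_def)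

lemma sum_fibre_swap: "(\<Sum>(i, j)\<in>fibre q l m. g i j) = (\<Sum>(i, j)\<in>fibre q l m. g j i)"
  by (rule sum.reindex_bij_witness[of _ prod.swap prod.swap]) (auto simp: fibre_def mult.commute)

lemma two_t_conv_coeff: "2 * t_conv_coeff q l b m = (\<Sum>(i, j)\<in>fibre q l m. b i * b j * (l i + l j))"
proof -
  have "t_conv_coeff q l b m = (\<Sum>(i, j)\<in>fibre q l m. b i * b j * l i)"
    unfolding t_conv_coeff_def by (subst sum_fibre_swap) (simp add: mult_ac)
  then show ?thesis
    by (simp add: t_conv_coeff_def sum.distrib case_prod_unfold distrib_left)
qed

lemma sum_indicator_fibre:
  "(\<Sum>(i, j)\<in>{..q} \<times> {..q}. g i j * indicator {m} (l i * l j)) = (\<Sum>(i, j)\<in>fibre q l m. g i j :: real)"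
  by (rule sum.mono_neutral_cong_right) (auto simp: fibre_def indicator_def)

section \<open>Positivity of the masses at the lowest products\<close>

text \<open>The hypotheses on charges, reduced to masses at points. Asking for positive nodes makes
  the class of such data closed under inversion.\<close>

locale positive_squares =
  fixes q :: nat and l b :: "nat \<Rightarrow> real"
  assumes mono: "strict_mono_on {..q} l"
    and l_pos: "\<And>k. k \<le> q \<Longrightarrow> 0 < l k"
    and b_nonzero: "\<And>k. k \<le> q \<Longrightarrow> b k \<noteq> 0"
    and coeff_nonneg: "\<And>m. 0 \<le> conv_coeff q l b m"
    and t_coeff_nonneg: "\<And>m. 0 \<le> t_conv_coeff q l b m"
begin

lemma l_less: "i < j \<Longrightarrow> j \<le> q \<Longrightarrow> l i < l j"
  using mono by (auto simp: strict_mono_on_def)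

lemma l_le: "i \<le> j \<Longrightarrow> j \<le> q \<Longrightarrow> l i \<le> l j"
  using l_less[of i j] by (cases "i = j") auto

lemma prod_less:
  assumes "i \<le> i'" and "j \<le> j'" and "i < i' \<or> j < j'" and "i' \<le> q" and "j' \<le> q"
  shows "l i * l j < l i' * l j'"
proof (cases "i < i'")
  case True
  with assms show ?thesis
    using l_less[of i i'] l_le[of j j'] l_pos[of i] l_pos[of j]
    by (intro mult_less_le_imp_less) auto
next
  case False
  with assms show ?thesis
    using l_le[of i i'] l_less[of j j'] l_pos[of i] l_pos[of j]
    by (intro mult_le_less_imp_less) auto
qed

lemma prod_le: "i \<le> i' \<Longrightarrow> j \<le> j' \<Longrightarrow> i' \<le> q \<Longrightarrow> j' \<le> q \<Longrightarrow> l i * l j \<le> l i' * l j'"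
  using prod_less[of i i' j j'] by (cases "i = i' \<and> j = j'") auto

text \<open>The product increases strictly in each index, so lowering one index must raise the
  other.\<close>

lemma fibre_antitone:
  assumes "(i, j) \<in> fibre q l m" and "(i', j') \<in> fibre q l m"
  shows "i = i' \<and> j = j' \<or> i < i' \<and> j' < j \<or> i' < i \<and> j < j'"
proof -
  have "l i * l j = l i' * l j'" "i \<le> q" "j \<le> q" "i' \<le> q" "j' \<le> q"
    using assms by (auto simp: fibre_def)
  then have "\<not> (i \<le> i' \<and> j \<le> j' \<and> (i < i' \<or> j < j'))" "\<not> (i' \<le> i \<and> j' \<le> j \<and> (i' < i \<or> j' < j))"
    using prod_less[of i i' j j'] prod_less[of i' i j' j] by (metis order_less_irrefl)+
  then show ?thesis
    by linarith
qed

lemma fibre_commute: "(i, j) \<in> fibre q l m \<Longrightarrow> (j, i) \<in> fibre q l m"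
  by (auto simp: fibre_def mult.commute)

lemma fibre_zero_cases:
  assumes "(0, j) \<in> fibre q l m" and "(i, k) \<in> fibre q l m"
  shows "(i, k) = (0, j) \<or> (i, k) = (j, 0) \<or> 0 < i \<and> 0 < k"
proof -
  have eq: "k = j" if "(0, k) \<in> fibre q l m" for k
    using fibre_antitone[OF assms(1) that] by auto
  show ?thesis
    using eq[of k] eq[of i] assms(2) fibre_commute[OF assms(2)] by (cases "i = 0"; cases "k = 0") auto
qed

text \<open>
  Among the pairs with a given product, the pair containing the smallest node has the largest sum.
  Hence it cannot be the negative part of a fibre: a negative outer pair that cancels the inner
  pairs in \<open>\<nu> * \<nu>\<close> would outweigh them in \<open>\<nu> * t\<nu>\<close>.
\<close>

lemma coeff_pos:
  assumes "fibre q l m \<noteq> {}"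
    and inner: "\<And>i k. (i, k) \<in> fibre q l m \<Longrightarrow> 0 < i \<Longrightarrow> 0 < k \<Longrightarrow> 0 < b i * b k"
  shows "0 < conv_coeff q l b m"
proof (cases "\<exists>j. (0, j) \<in> fibre q l m")
  case False
  then have "0 < i \<and> 0 < k" if "(i, k) \<in> fibre q l m" for i k
    using that fibre_commute[OF that] by (auto intro!: Nat.gr0I)
  with assms show ?thesis
    unfolding conv_coeff_def by (intro sum_pos finite_fibre) auto
next
  case True
  then obtain j where j: "(0, j) \<in> fibre q l m" by blast
  let ?s = "l 0 + l j" and ?I = "{(i, k) \<in> fibre q l m. 0 < i \<and> 0 < k}"
  have fin: "finite ?I"
    by (rule finite_subset[OF _ finite_fibre[of q l m]]) auto
  show ?thesis
  proof (cases "?I = {}")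
    case True
    then have fib: "fibre q l m = {(0, j), (j, 0)}"
      using fibre_zero_cases[OF j] j fibre_commute[OF j] by fast
    have "b 0 \<noteq> 0" "b j \<noteq> 0"
      using j b_nonzero by (auto simp: fibre_def)
    \<comment> \<open>Up to order there is only one pair, so nothing can cancel.\<close>
    then have "conv_coeff q l b m \<noteq> 0"
      unfolding conv_coeff_def fib by (cases "j = 0") (auto simp: mult.commute)
    then show ?thesis
      using coeff_nonneg[of m] by simp
  next
    case False
    have sum_less: "l i + l k < ?s" if "(i, k) \<in> ?I" for i k
    proof -
      have "0 < (l i - l 0) * (l k - l 0)"
        using that l_less[of 0 i] l_less[of 0 k] by (auto simp: fibre_def)
      also have "\<dots> = l 0 * (?s - (l i + l k))"
        using that j by (auto simp: fibre_def algebra_simps)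
      finally show ?thesis
        using l_pos[of 0] by (simp add: zero_less_mult_iff)
    qed
    \<comment> \<open>The weight \<open>?s - (l i + l k)\<close> vanishes on the outer pair and is
      positive on the inner ones.\<close>
    have "0 < (\<Sum>(i, k)\<in>?I. b i * b k * (?s - (l i + l k)))"
      using inner sum_less by (intro sum_pos fin False) auto
    also have "\<dots> = (\<Sum>(i, k)\<in>fibre q l m. b i * b k * (?s - (l i + l k)))"
      by (rule sum.mono_neutral_left[OF finite_fibre]) (use fibre_zero_cases[OF j] in fastforce)+
    also have "\<dots> = ?s * conv_coeff q l b m - 2 * t_conv_coeff q l b m"
      unfolding two_t_conv_coeff conv_coeff_def
      by (simp add: sum_subtractf[symmetric] sum_distrib_left case_prod_unfold algebra_simps)
    finally have "0 < ?s * conv_coeff q l b m"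
      using t_coeff_nonneg[of m] by linarith
    moreover have "0 < ?s"
      using j l_pos[of 0] l_pos[of j] by (auto simp: fibre_def)
    ultimately show ?thesis
      by (simp add: zero_less_mult_iff)
  qed
qed

text \<open>The only possible inner pair is (1, 1), which contributes a square.\<close>

lemma coeff_pos_upto_square_1:
  assumes "1 \<le> q" and "fibre q l m \<noteq> {}" and "m \<le> l 1 * l 1"
  shows "0 < conv_coeff q l b m"
proof (rule coeff_pos[OF assms(2)])
  fix i k assume ik: "(i, k) \<in> fibre q l m" "0 < i" "0 < k"
  then have "i = 1 \<and> k = 1"
    using prod_less[of 1 i 1 k] assms(3) by (fastforce simp: fibre_def)
  then show "0 < b i * b k"
    using b_nonzero[of 1] assms(1) by (simp add: zero_less_mult_iff) linarith
qed

text \<open>Without inner pairs the mass is just 2 b_0 b_j.\<close>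

lemma b_0_mult_pos:
  assumes "0 < j" and "j \<le> q"
    and no_inner: "\<And>i k. (i, k) \<in> fibre q l (l 0 * l j) \<Longrightarrow> 0 < i \<Longrightarrow> 0 < k \<Longrightarrow> False"
  shows "0 < b 0 * b j"
proof -
  have j: "(0, j) \<in> fibre q l (l 0 * l j)"
    using assms by (simp add: fibre_def)
  then have "fibre q l (l 0 * l j) = {(0, j), (j, 0)}"
    using fibre_zero_cases[OF j] no_inner fibre_commute[OF j] by fast
  then have "conv_coeff q l b (l 0 * l j) = 2 * (b 0 * b j)"
    using assms(1) by (simp add: conv_coeff_def)
  moreover have "b 0 \<noteq> 0" "b j \<noteq> 0"
    using assms(2) b_nonzero by auto
  ultimately show ?thesis
    using coeff_nonneg[of "l 0 * l j"] by (simp add: order_less_le)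
qed

lemma b_0_b_1_pos:
  assumes "1 \<le> q"
  shows "0 < b 0 * b 1"
proof (rule b_0_mult_pos)
  fix i k assume "(i, k) \<in> fibre q l (l 0 * l 1)" "0 < i" "0 < k"
  then show False
    using prod_less[of 0 i 1 k] by (auto simp: fibre_def)
qed (use assms in auto)

section \<open>Inversion of the nodes\<close>

text \<open>The nodes of the image of \<nu> under t -> 1/t; reversing the indices keeps them
  increasing.\<close>

definition l_rev :: "nat \<Rightarrow> real" where "l_rev i = inverse (l (q - i))"

definition b_rev :: "nat \<Rightarrow> real" where "b_rev i = b (q - i)"

lemma sum_fibre_rev:
  "(\<Sum>(i, j)\<in>fibre q l_rev m. g i j) = (\<Sum>(i, j)\<in>fibre q l (inverse m). g (q - i) (q - j))"
proof (rule sum.reindex_bij_witness[of _ "map_prod (\<lambda>i. q - i) (\<lambda>j. q - j)" "map_prod (\<lambda>i. q - i) (\<lambda>j. q - j)"])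
qed (auto simp: fibre_def l_rev_def simp flip: inverse_mult_distrib)

lemma conv_coeff_rev: "conv_coeff q l_rev b_rev m = conv_coeff q l b (inverse m)"
  unfolding conv_coeff_def sum_fibre_rev
  by (intro sum.cong refl) (auto simp: b_rev_def fibre_def)

text \<open>Where l_i l_j = 1/m, the inverted weight 1/l_j equals m l_i, and swapping the pair turns
  l_i into l_j.\<close>

lemma t_conv_coeff_rev: "t_conv_coeff q l_rev b_rev m = m * t_conv_coeff q l b (inverse m)"
proof -
  have "inverse (l j) = m * l i" if "(i, j) \<in> fibre q l (inverse m)" for i j
  proof -
    have "l i * l j = inverse m" "0 < l i" "0 < l j"
      using that l_pos by (auto simp: fibre_def)
    then show ?thesis
      by (metis inverse_inverse_eq inverse_mult_distrib mult.assoc mult.commute mult.right_neutral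
          order_less_irrefl right_inverse)
  qed
  then have "t_conv_coeff q l_rev b_rev m = (\<Sum>(i, j)\<in>fibre q l (inverse m). m * (b i * b j * l i))"
    unfolding t_conv_coeff_def sum_fibre_rev
    by (intro sum.cong refl) (auto simp: b_rev_def l_rev_def fibre_def)
  also have "\<dots> = (\<Sum>(i, j)\<in>fibre q l (inverse m). m * (b i * b j * l j))"
    by (subst sum_fibre_swap) (simp add: mult_ac)
  finally show ?thesis
    by (simp add: t_conv_coeff_def sum_distrib_left case_prod_unfold)
qed

lemma positive_squares_rev: "positive_squares q l_rev b_rev"
proof
  show "strict_mono_on {..q} l_rev"
    using l_less l_pos by (auto simp: strict_mono_on_def l_rev_def)
  show "0 \<le> t_conv_coeff q l_rev b_rev m" for m
  \<comment> \<open>The factor \<open>m\<close> must not spoil the sign: a nonempty fibre forces it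
    to be positive, and an empty one gives an empty sum.\<close>
  proof (cases "fibre q l (inverse m) = {}")
    case False
    then obtain i j where "i \<le> q" "j \<le> q" "l i * l j = inverse m"
      by (auto simp: fibre_def)
    then have "0 < inverse m"
      using mult_pos_pos[OF l_pos l_pos, of i j] by simp
    then show ?thesis
      using t_coeff_nonneg by (simp add: t_conv_coeff_rev)
  qed (simp add: t_conv_coeff_rev, simp add: t_conv_coeff_def)
qed (use l_pos b_nonzero coeff_nonneg in \<open>auto simp: l_rev_def b_rev_def conv_coeff_rev\<close>)

text \<open>The mirror image of \<open>coeff_pos_upto_square_1\<close>, since \<open>l_rev 1\<close>
  is the inverse of \<open>l (q - 1)\<close>.\<close>

lemma coeff_pos_from_square_last:
  assumes "1 \<le> q" and "(i, j) \<in> fibre q l m" and "l (q - 1) * l (q - 1) \<le> m"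
  shows "0 < conv_coeff q l b m"
proof -
  interpret rev: positive_squares q l_rev b_rev
    by (rule positive_squares_rev)
  have "(q - i, q - j) \<in> fibre q l_rev (inverse m)"
    using assms(2) by (auto simp: fibre_def l_rev_def)
  moreover have "inverse m \<le> inverse (l (q - 1) * l (q - 1))"
    using assms(3) l_pos[of "q - 1"] by (intro le_imp_inverse_le) auto
  ultimately have "0 < conv_coeff q l_rev b_rev (inverse m)"
    using assms(1) by (intro rev.coeff_pos_upto_square_1) (auto simp: l_rev_def)
  then show ?thesis
    by (simp add: conv_coeff_rev)
qed

lemma b_last_pos:
  assumes "1 \<le> q"
  shows "0 < b (q - 1) * b q"
  using positive_squares.b_0_b_1_pos[OF positive_squares_rev assms] by (simp add: b_rev_def mult.commute)

section \<open>Counting atoms\<close>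

text \<open>
  The products of the two lowest nodes and those of the two highest are six atoms already. If there are no others, the
  nodes 0 to 3 are in geometric progression with coefficient signs \<open>+ + - +\<close>, up to a global sign,
  and then \<open>l 2 * l 2\<close> is a seventh atom.
\<close>

lemma more_than_six_atoms:
  assumes q: "4 \<le> q" and S: "finite S" "\<And>m. conv_coeff q l b m \<noteq> 0 \<Longrightarrow> m \<in> S"
  shows "6 < card S"
proof (rule ccontr)
  assume "\<not> 6 < card S"
  let ?T = "{l 0 * l 0, l 0 * l 1, l 1 * l 1, l (q - 1) * l (q - 1), l (q - 1) * l q, l q * l q}"
  \<comment> \<open>\<open>4 \<le> q\<close> gives 2 < q - 1, which separates the low products from
    those of the two highest nodes.\<close>
  have order: "l 0 * l 0 < l 0 * l 1" "l 0 * l 1 < l 1 * l 1" "l 1 * l 1 < l 1 * l 2"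
    "l 1 * l 2 < l 2 * l 2" "l 2 * l 2 < l (q - 1) * l (q - 1)"
    "l (q - 1) * l (q - 1) < l (q - 1) * l q" "l (q - 1) * l q < l q * l q"
    "l 0 * l 1 < l 0 * l 2" "l 0 * l 2 < l 1 * l 2" "l 0 * l 2 < l 0 * l 3"
    using q by (auto intro!: prod_less)
  have low: "0 < conv_coeff q l b (l i * l j)" if "l i * l j \<le> l 1 * l 1" "i \<le> q" "j \<le> q" for i j
    using q that by (intro coeff_pos_upto_square_1) (auto simp: fibre_def)
  have high: "0 < conv_coeff q l b (l i * l j)"
    if "l (q - 1) * l (q - 1) \<le> l i * l j" "i \<le> q" "j \<le> q" for i j
    using q that by (intro coeff_pos_from_square_last[of i j]) (auto simp: fibre_def)
  have "0 < conv_coeff q l b m" if "m \<in> ?T" for m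
    using that q order low[of 0 0] low[of 0 1] low[of 1 1]
      high[of "q - 1" "q - 1"] high[of "q - 1" q] high[of q q] by auto
  then have "?T \<subseteq> S"
    using S(2) by (metis order_less_irrefl subsetI)
  moreover have "card ?T = 6"
  proof -
    have "distinct [l 0 * l 0, l 0 * l 1, l 1 * l 1, l (q - 1) * l (q - 1), l (q - 1) * l q, l q * l q]"
      using order by (intro strict_sorted_iff[THEN iffD1, THEN conjunct2]) simp
    from distinct_card[OF this] show ?thesis
      by simp
  qed
  ultimately have "S = ?T"
    using \<open>\<not> 6 < card S\<close> card_seteq[OF S(1), of ?T] by auto
  \<comment> \<open>The six atoms exhaust \<open>S\<close>, so any other product up to
    \<open>l 2 * l 2\<close> has mass zero.\<close>
  then have zero: "conv_coeff q l b m = 0" if "l 0 * l 1 < m" "m \<noteq> l 1 * l 1" "m \<le> l 2 * l 2" for m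
    using that S(2)[of m] order by auto
  have inner11: "i = 1 \<and> k = 1"
    if "(i, k) \<in> fibre q l m" "0 < i" "0 < k" "m < l 1 * l 2" for i k m
  proof -
    have "l i * l k < l 1 * l 2" "i \<le> q" "k \<le> q"
      using that by (auto simp: fibre_def)
    then have "\<not> (1 \<le> i \<and> 2 \<le> k)" "\<not> (2 \<le> i \<and> 1 \<le> k)"
      using prod_le[of 1 i 2 k] prod_le[of 2 i 1 k] by (auto simp: mult.commute)
    with that show ?thesis
      by linarith
  qed
  \<comment> \<open>Only (1, 1) could be an inner pair over \<open>l 0 * l 2\<close>; without it,
    \<open>l 0 * l 2\<close> would be a seventh atom.\<close>
  have l02: "l 0 * l 2 = l 1 * l 1"
  proof (rule ccontr)
    assume ne: "l 0 * l 2 \<noteq> l 1 * l 1"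
    have "0 < conv_coeff q l b (l 0 * l 2)"
    proof (rule coeff_pos)
      have "(0, 2) \<in> fibre q l (l 0 * l 2)"
        using q by (simp add: fibre_def)
      then show "fibre q l (l 0 * l 2) \<noteq> {}"
        by blast
      fix i k assume ik: "(i, k) \<in> fibre q l (l 0 * l 2)" "0 < i" "0 < k"
      then have "i = 1 \<and> k = 1"
        using inner11 order by blast
      with ik ne show "0 < b i * b k"
        by (auto simp: fibre_def)
    qed
    then show False
      using zero[of "l 0 * l 2"] ne order by auto
  qed
  have pos03: "0 < conv_coeff q l b (l 0 * l 3)" if "l 0 * l 3 < l 1 * l 2"
  proof (rule coeff_pos)
    have "(0, 3) \<in> fibre q l (l 0 * l 3)"
      using q by (simp add: fibre_def)
    then show "fibre q l (l 0 * l 3) \<noteq> {}"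
      by blast
    fix i k assume ik: "(i, k) \<in> fibre q l (l 0 * l 3)" "0 < i" "0 < k"
    then have "i = 1 \<and> k = 1"
      using inner11 that by blast
    with ik show "0 < b i * b k"
      using l02 order by (auto simp: fibre_def)
  qed
  have l03: "l 1 * l 2 \<le> l 0 * l 3"
    using pos03 zero[of "l 0 * l 3"] order l02 by fastforce
  have f12: "(1, 2) \<in> fibre q l (l 1 * l 2)" "(2, 1) \<in> fibre q l (l 1 * l 2)"
    using q by (auto simp: fibre_def)
  have inner12: "(i, k) = (1, 2) \<or> (i, k) = (2, 1)"
    if "(i, k) \<in> fibre q l (l 1 * l 2)" "0 < i" "0 < k" for i k
    using fibre_antitone[OF that(1) f12(1)] fibre_antitone[OF that(1) f12(2)] that(2,3)
    unfolding prod.inject by linarith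
  have zero12: "conv_coeff q l b (l 1 * l 2) = 0"
    by (rule zero) (use order in linarith)+
  have b12: "b 1 * b 2 < 0"
  proof (rule ccontr)
    assume "\<not> b 1 * b 2 < 0"
    then have "0 < b 1 * b 2"
      using b_nonzero[of 1] b_nonzero[of 2] q by (simp add: order_less_le)
    then have "0 < conv_coeff q l b (l 1 * l 2)"
      using inner12 f12 by (intro coeff_pos) (force simp: mult.commute)+
    then show False
      using zero12 by simp
  qed
  \<comment> \<open>The negative contribution of (1, 2) must be cancelled, which takes a pair with
    the smallest node; the order of the products then forces its partner to be 3.\<close>
  have "\<exists>j. (0, j) \<in> fibre q l (l 1 * l 2)"
  proof (rule ccontr)
    assume no: "\<nexists>j. (0, j) \<in> fibre q l (l 1 * l 2)"
    then have "0 < i \<and> 0 < k" if "(i, k) \<in> fibre q l (l 1 * l 2)" for i k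
      using that fibre_commute[OF that] by (auto intro!: Nat.gr0I)
    then have fib: "fibre q l (l 1 * l 2) = {(1, 2), (2, 1)}"
      using f12 inner12 by fast
    have "conv_coeff q l b (l 1 * l 2) = 2 * (b 1 * b 2)"
      unfolding conv_coeff_def fib by simp
    then show False
      using zero12 b12 by linarith
  qed
  then obtain j where j: "(0, j) \<in> fibre q l (l 1 * l 2)" by blast
  have "3 \<le> j"
  proof (rule ccontr)
    assume "\<not> 3 \<le> j"
    then have "l 0 * l j \<le> l 0 * l 2"
      using q by (intro prod_le) auto
    with j order show False
      by (simp add: fibre_def)
  qed
  moreover have "j \<le> 3"
    using prod_less[of 0 0 3 j] j l03 by (force simp: fibre_def)
  ultimately have "j = 3" by simp
  note f03 = j[unfolded this]
  have eq03: "l 0 * l 3 = l 1 * l 2"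
    using f03 by (simp add: fibre_def)
  have fib: "fibre q l (l 1 * l 2) = {(0, 3), (3, 0), (1, 2), (2, 1)}"
    using fibre_zero_cases[OF f03] fibre_commute[OF f03] f03 inner12 f12 by fast
  have "conv_coeff q l b (l 1 * l 2) = 2 * (b 0 * b 3) + 2 * (b 1 * b 2)"
    unfolding conv_coeff_def fib by simp
  with zero12 b12 have "0 < b 0 * b 3" by linarith
  then have b13: "0 < b 1 * b 3"
    using b_0_b_1_pos q by (auto simp: zero_less_mult_iff)
  \<comment> \<open>The nodes 0 to 3 are now in geometric progression, which puts (1, 3) and (2, 2)
    over the same product.\<close>
  have "l 0 * (l 1 * l 3) = l 1 * (l 0 * l 3)"
    by simp
  also have "\<dots> = (l 1 * l 1) * l 2"
    unfolding eq03 by simp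
  also have "\<dots> = l 0 * (l 2 * l 2)"
    unfolding l02[symmetric] by simp
  finally have "l 1 * l 3 = l 2 * l 2"
    using l_pos[of 0] by simp
  then have f13: "(1, 3) \<in> fibre q l (l 2 * l 2)" "(3, 1) \<in> fibre q l (l 2 * l 2)"
    using q by (simp_all add: fibre_def mult.commute)
  have f22: "(2, 2) \<in> fibre q l (l 2 * l 2)"
    using q by (simp add: fibre_def)
  have "0 < conv_coeff q l b (l 2 * l 2)"
  proof (rule coeff_pos)
    show "fibre q l (l 2 * l 2) \<noteq> {}"
      using f22 by auto
    fix i k assume ik: "(i, k) \<in> fibre q l (l 2 * l 2)" "0 < i" "0 < k"
    have "(i, k) = (1, 3) \<or> (i, k) = (2, 2) \<or> (i, k) = (3, 1)"
      using fibre_antitone[OF ik(1) f13(1)] fibre_antitone[OF ik(1) f13(2)]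
        fibre_antitone[OF ik(1) f22] ik(2,3) unfolding prod.inject by linarith
    then show "0 < b i * b k"
      using b13 b_nonzero[of 2] q by (auto simp: mult.commute zero_less_mult_iff)
  qed
  then show False
    using zero[of "l 2 * l 2"] order by auto
qed

text \<open>At most four nodes remain. The two lowest coefficients agree in sign, and so do the two
  highest, which links all of them except in the case of four nodes.\<close>

lemma constant_sign:
  assumes S: "finite S" "\<And>m. conv_coeff q l b m \<noteq> 0 \<Longrightarrow> m \<in> S" and "card S \<le> 6"
  shows "(\<forall>k\<le>q. 0 < b k) \<or> (\<forall>k\<le>q. b k < 0)"
proof -
  have "q \<le> 3"
    using more_than_six_atoms[of S] S assms(3) by fastforce
  then consider "q = 0" | "q = 1" | "q = 2" | "q = 3" by linarith
  then show ?thesis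
  proof cases
    case 1
    then show ?thesis
      using b_nonzero[of 0] by auto
  next
    case 2
    then show ?thesis
      using b_0_b_1_pos by (auto simp: zero_less_mult_iff le_Suc_eq)
  next
    case 3
    then show ?thesis
      using b_0_b_1_pos b_last_pos by (auto simp: zero_less_mult_iff le_Suc_eq numeral_2_eq_2)
  next
    case 4
    have b01: "0 < b 0 * b 1" and b23: "0 < b 2 * b 3"
      using b_0_b_1_pos b_last_pos 4 by auto
    \<comment> \<open>If the two halves had opposite signs, every pair over
      \<open>l 1 * l 2\<close>, namely (1, 2), possibly (0, 3), and their swaps, would contribute
      negatively.\<close>
    have "0 < b 1 * b 2"
    proof (rule ccontr)
      assume "\<not> 0 < b 1 * b 2"
      then have b12: "b 1 * b 2 < 0"
        using b01 b23 by (auto simp: zero_less_mult_iff mult_less_0_iff)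
      then have b03: "b 0 * b 3 < 0"
        using b01 b23 by (auto simp: zero_less_mult_iff mult_less_0_iff)
      have f12: "(1, 2) \<in> fibre q l (l 1 * l 2)" "(2, 1) \<in> fibre q l (l 1 * l 2)"
        using 4 by (auto simp: fibre_def)
      have "b i * b k < 0" if ik: "(i, k) \<in> fibre q l (l 1 * l 2)" for i k
      proof -
        have "i \<le> 3" "k \<le> 3"
          using ik 4 by (auto simp: fibre_def)
        then have "i = 0 \<and> k = 3 \<or> i = 3 \<and> k = 0 \<or> i = 1 \<and> k = 2 \<or> i = 2 \<and> k = 1"
          using fibre_antitone[OF ik f12(1)] fibre_antitone[OF ik f12(2)] by linarith
        then show ?thesis
          using b12 b03 by (auto simp: mult.commute)
      qed
      then have "0 < (\<Sum>(i, j)\<in>fibre q l (l 1 * l 2). - (b i * b j))"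
        using f12 by (intro sum_pos finite_fibre) auto
      then show False
        using coeff_nonneg[of "l 1 * l 2"] by (simp add: conv_coeff_def case_prod_unfold sum_negf)
    qed
    with b01 b23 4 show ?thesis
      by (auto simp: zero_less_mult_iff le_Suc_eq numeral_2_eq_2 numeral_3_eq_3)
  qed
qed

end

section \<open>Passage from charges to point masses\<close>

theorem theorem4p5:
  fixes p q :: nat and b l :: "nat \<Rightarrow> real" and \<nu> \<mu> :: "real set \<Rightarrow> real"
  assumes "1 \<le> p" and "p \<le> 6"
    and "strict_mono_on {..q} l"
    and "\<forall>k\<le>q. 1 \<le> l k"
    and "\<forall>k\<le>q. b k \<noteq> 0"
    and "\<nu> = (\<lambda>E. \<Sum>k\<le>q. b k * dirac (l k) E)"
    and "\<mu> = mult_convolution \<nu> \<nu>"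
    and "positive_charge \<mu>" and "p_atomic p \<mu>"
    and "positive_charge (mult_convolution \<nu> (times_t \<nu>))"
  shows "((\<forall>k\<le>q. b k > 0) \<or> (\<forall>k\<le>q. b k < 0)) \<and> (\<exists>\<xi>. positive_square_root \<xi> \<mu>)"
proof -
  have inj: "inj_on l {..q}"
    using assms(3) by (rule strict_mono_on_imp_inj_on)
  note conv = mult_convolution_dirac_sum[OF finite_atMost inj finite_atMost inj]
  \<comment> \<open>Evaluating both convolutions on singletons turns the hypotheses on charges into
    those of the locale.\<close>
  have \<mu>_singleton: "\<mu> {m} = conv_coeff q l b m" for m
    unfolding assms(6,7) by (subst conv) (simp_all add: sum_indicator_fibre conv_coeff_def)
  have t_singleton: "mult_convolution \<nu> (times_t \<nu>) {m} = t_conv_coeff q l b m" for m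
    unfolding assms(6) times_t_dirac_sum[OF finite_atMost inj]
    by (subst conv) (simp_all add: sum_indicator_fibre t_conv_coeff_def flip: mult.assoc)
  interpret positive_squares q l b
  proof
    show "0 \<le> conv_coeff q l b m" for m
      using assms(8) \<mu>_singleton[of m] by (metis positive_charge_def)
    show "0 \<le> t_conv_coeff q l b m" for m
      using assms(10) t_singleton[of m] by (metis positive_charge_def)
    show "0 < l k" if "k \<le> q" for k
      using assms(4) that by fastforce
  qed (use assms(3,5) in auto)
  obtain S c where S: "finite S" "card S = p" "\<mu> = (\<lambda>E. \<Sum>s\<in>S. c s * dirac s E)"
    using assms(9) unfolding p_atomic_def by blast
  have "m \<in> S" if "conv_coeff q l b m \<noteq> 0" for m
  proof (rule ccontr)
    assume "m \<notin> S"
    then have "\<mu> {m} = 0"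
      unfolding S(3) by (intro sum.neutral) (auto simp: dirac_eq_indicator indicator_def)
    then show False
      using that \<mu>_singleton by simp
  qed
  then have sign: "(\<forall>k\<le>q. 0 < b k) \<or> (\<forall>k\<le>q. b k < 0)"
    using S assms(2) by (intro constant_sign[of S]) auto
  \<comment> \<open>The absolute value of \<nu>: under constant sign, passing to absolute values
    changes no product b_i b_j.\<close>
  let ?\<xi> = "\<lambda>E. \<Sum>k\<le>q. \<bar>b k\<bar> * dirac (l k) E"
  have "positive_charge ?\<xi>"
    unfolding positive_charge_def
    by (intro conjI allI charge_dirac_sum sum_nonneg) (auto simp: dirac_def)
  moreover have "?\<xi> {..<0} = 0"
    using l_pos by (intro sum.neutral) (fastforce simp: dirac_eq_indicator indicator_def)
  moreover have "mult_convolution ?\<xi> ?\<xi> = \<mu>"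
  proof
    fix E
    have "\<bar>b i\<bar> * \<bar>b j\<bar> = b i * b j" if "i \<le> q" "j \<le> q" for i j
    proof -
      have "0 < b i * b j"
        using sign that by (auto intro: mult_pos_pos mult_neg_neg)
      then show ?thesis
        by (simp flip: abs_mult)
    qed
    then show "mult_convolution ?\<xi> ?\<xi> E = \<mu> E"
      unfolding assms(6,7)
      by (cases "E \<in> sets borel")
        (auto simp: conv intro!: sum.cong, simp add: mult_convolution_def)
  qed
  ultimately show ?thesis
    using sign by (auto simp: positive_square_root_def)
qed

end
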